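(* Let $n\ge1$. Let $M\subseteq\beta(\mathbb{Z}^n)$ be a minimal nonempty closed subset invariant under all shifts $h_N$, $N\in\mathbb{Z}^n$ (so that $M$ is homeomorphic to the phase space $M(\mathbb{Z}^n)$ of the universal minimal flow of $\mathbb{Z}^n$). Then the phase space $M(\mathbb{R}^n)$ of the universal minimal dynamical system of the additive group $\mathbb{R}^n$ (Euclidean topology) is homeomorphic to $(M\times\mathbb{I}^n)/h$, i.e. to $M(\mathbb{Z}^n)\times\mathbb{I}^n/h$.
   Context: $\mathbb{I}=[0,1]$; $\beta(\mathbb{Z}^n)$ is the Čech–Stone compactification of the discrete group $\mathbb{Z}^n$, and for $N\in\mathbb{Z}^n$, $h_N$ is the continuous extension to $\beta(\mathbb{Z}^n)$ of the translation $\vec z\mapsto\vec z+N$. For $A\subseteq\{1,\dots,n\}$, $\mathbf{1}_A\in\{0,1\}^n$ is its indicator vector and $\psi_A(\vec i)$ is obtained from $\vec i\in\mathbb{I}^n$ by replacing, for $a\in A$, a coordinate $i_a=1$ by $0$ and a coordinate $i_a=0$ by $1$. The equivalence relation $h$ on $\beta(\mathbb{Z}^n)\times\mathbb{I}^n$ (and its restriction to $M\times\mathbb{I}^n$) identifies $(p,\vec i)$ with $(h_{\mathbf{1}_A}(p),\psi_A(\vec i))$ whenever $A\subseteq\{j:i_j=1\}$. A dynamical system is a continuous action of a topological group on a compact Hausdorff space; it is minimal if every orbit is dense. The universal minimal dynamical system (universal minimal flow) of a group $G$ is the minimal system that maps homomorphically (continuously and equivariantly) onto every minimal system of $G$; it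 is unique up to isomorphism, and its phase space is denoted $M(G)$. *)

theory Defs
  imports "HOL-Analysis.Analysis"
begin

definition is_ultrafilter :: "'a filter \<Rightarrow> bool" where
  "is_ultrafilter F \<longleftrightarrow> F \<noteq> bot \<and>
     (\<forall>A. eventually (\<lambda>x. x \<in> A) F \<or> eventually (\<lambda>x. x \<notin> A) F)"

definition beta_Zn :: "(int^'n) filter topology" where
  "beta_Zn = topology_generated_by
     {{U. is_ultrafilter U \<and> eventually (\<lambda>x. x \<in> A) U} | A. True}"

text \<open>h_N: the continuous extension of the translation z \<mapsto> z + N (push-forward of ultrafilters).\<close>
definition shift_beta :: "int^'n \<Rightarrow> (int^'n) filter \<Rightarrow> (int^'n) filter" where
  "shift_beta N p = filtermap (\<lambda>z. z + N) p"

definition invariant_closed :: "(int^'n) filter set \<Rightarrow> bool" where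
  "invariant_closed M \<longleftrightarrow> M \<noteq> {} \<and> closedin beta_Zn M \<and>
     (\<forall>N. shift_beta N ` M \<subseteq> M)"

definition minimal_invariant_subset :: "(int^'n) filter set \<Rightarrow> bool" where
  "minimal_invariant_subset M \<longleftrightarrow> invariant_closed M \<and>
     (\<forall>M'. invariant_closed M' \<and> M' \<subseteq> M \<longrightarrow> M' = M)"

definition cube :: "(real^'n) set" where
  "cube = {x. \<forall>j. 0 \<le> x $ j \<and> x $ j \<le> 1}"

definition cube_top :: "(real^'n) topology" where
  "cube_top = subtopology euclidean cube"

definition indic_vec :: "'n set \<Rightarrow> int^'n" where
  "indic_vec A = (\<chi> j. if j \<in> A then 1 else 0)"

definition psi :: "'n set \<Rightarrow> real^'n \<Rightarrow> real^'n" where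
  "psi A i = (\<chi> j. if j \<in> A then (if i $ j = 1 then 0 else if i $ j = 0 then 1 else i $ j)
                     else i $ j)"

definition h_basic :: "(int^'n) filter set \<Rightarrow>
    (((int^'n) filter \<times> (real^'n)) \<times> ((int^'n) filter \<times> (real^'n))) set" where
  "h_basic M = {((p, i), (shift_beta (indic_vec A) p, psi A i)) | p i A.
                 p \<in> M \<and> i \<in> cube \<and> A \<subseteq> {j. i $ j = 1}}"

definition h_rel :: "(int^'n) filter set \<Rightarrow>
    (((int^'n) filter \<times> (real^'n)) \<times> ((int^'n) filter \<times> (real^'n))) set" where
  "h_rel M = Id_on (M \<times> cube) \<union> (h_basic M \<union> (h_basic M)\<inverse>)\<^sup>+"

definition quotient_topology :: "'a topology \<Rightarrow> ('a \<times> 'a) set \<Rightarrow> 'a set topology" where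
  "quotient_topology X R =
     topology (\<lambda>U. U \<subseteq> topspace X // R \<and> openin X (\<Union>U))"

definition is_flow :: "'x topology \<Rightarrow> (real^'n \<Rightarrow> 'x \<Rightarrow> 'x) \<Rightarrow> bool" where
  "is_flow X act \<longleftrightarrow> compact_space X \<and> Hausdorff_space X \<and>
     (\<forall>g. \<forall>x\<in>topspace X. act g x \<in> topspace X) \<and>
     (\<forall>x\<in>topspace X. act 0 x = x) \<and>
     (\<forall>g h. \<forall>x\<in>topspace X. act (g + h) x = act g (act h x)) \<and>
     continuous_map (prod_topology euclidean X) X (\<lambda>(g, x). act g x)"

definition minimal_flow :: "'x topology \<Rightarrow> (real^'n \<Rightarrow> 'x \<Rightarrow> 'x) \<Rightarrow> bool" where
  "minimal_flow X act \<longleftrightarrow> is_flow X act \<and> topspace X \<noteq> {} \<and>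
     (\<forall>x\<in>topspace X. X closure_of (range (\<lambda>g. act g x)) = topspace X)"

definition flow_hom_onto :: "'x topology \<Rightarrow> (real^'n \<Rightarrow> 'x \<Rightarrow> 'x) \<Rightarrow>
    'y topology \<Rightarrow> (real^'n \<Rightarrow> 'y \<Rightarrow> 'y) \<Rightarrow> ('x \<Rightarrow> 'y) \<Rightarrow> bool" where
  "flow_hom_onto X act Y act' f \<longleftrightarrow> continuous_map X Y f \<and> f ` topspace X = topspace Y \<and>
     (\<forall>g. \<forall>x\<in>topspace X. f (act g x) = act' g (f x))"

text \<open>Universality is tested against all minimal systems carried by the type
  (real^'n) set set, of cardinality 2^(2^c); every minimal R^n-system (a continuous image of
  beta of the discrete group R^n) is isomorphic to one carried by this type.\<close>
definition universal_minimal_flow :: "'x topology \<Rightarrow> (real^'n \<Rightarrow> 'x \<Rightarrow> 'x) \<Rightarrow> bool" where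
  "universal_minimal_flow X act \<longleftrightarrow> minimal_flow X act \<and>
     (\<forall>(Y :: (real^'n) set set topology) act'. minimal_flow Y act' \<longrightarrow>
        (\<exists>f. flow_hom_onto X act Y act' f))"

end

(* Let Q be the suspension (M x R^n)/Z^n, which is the quotient of M x I^n by h. Its point [p, x] can be
   read as the ultrafilter p + x on the discrete group R^n, and R^n acts by translation; Q is compact
   Hausdorff and minimal, so a universal minimal flow X has a homomorphism g onto Q. By Ellis' lemma M
   contains an idempotent u, and p u = p on M by minimality. Choose x0 in X with g x0 = [u, 0]. The map
   (p, x) |-> x . lim_(z -> p) (z . x0) from M x R^n factors through Q and is onto X by minimality of X,
   and following it by g gives [p, x] |-> [p u, x] = [p, x]. Hence it induces a continuous bijection
   from Q onto X. *)
theory Submission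
  imports Defs
begin

subsection \<open>Ultrafilters and the topology of beta Z^n\<close>

text \<open>The obstacle is injectivity of the map from Q to X. For a base point over an arbitrary
  [q, 0], going to X and back by g is [p, x] |-> [p q, x], an endomorphism of Q that would need an
  injectivity argument of its own; a right identity u turns it into the identity. The argument
  applies to every minimal flow that maps homomorphically onto Q, and universality supplies such a
  map. The product is one-sided: p q is the limit of the shifts of q along p, hence continuous in p
  for fixed q. This is the side needed both for Ellis' lemma and for limits along p of an orbit. Q
  is handled in two presentations. M x R^n carries the translation action, and its projection to Q
  is open because Z^n acts by homeomorphisms; Hausdorffness comes from there. M x I^n is compact and
  carries h. They are linked by \<open>translate\<close>, whose fibres on M x I^n are exactly the
  classes of h, so X and (M x I^n)/h end up as quotients of one compact space by the same
  relation.\<close>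

lemma ultrafilter_exists:
  assumes "F \<noteq> bot"
  shows "\<exists>U. is_ultrafilter U \<and> U \<le> F"
proof -
  let ?A = "{G. G \<noteq> bot \<and> G \<le> F}"
  have "\<exists>m\<in>?A. \<forall>a\<in>?A. a \<le> m \<longrightarrow> a = m"
  proof (rule predicate_Zorn)
    show "partial_order_on ?A (relation_of (\<lambda>x y. y \<le> x) ?A)"
      by (rule partial_order_on_relation_ofI) auto
    fix C assume C: "C \<in> Chains (relation_of (\<lambda>x y. y \<le> x) ?A)"
    then have CA: "C \<subseteq> ?A" and chain: "\<And>G H. G \<in> C \<Longrightarrow> H \<in> C \<Longrightarrow> G \<le> H \<or> H \<le> G"
      by (auto simp: Chains_def relation_of_def)
    show "\<exists>u\<in>?A. \<forall>a\<in>C. u \<le> a"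
    proof (cases "C = {}")
      case True
      with assms show ?thesis by auto
    next
      case False
      \<comment> \<open>A chain is directed, so whatever holds eventually for \<open>Inf C\<close>
        already does so for one member; properness therefore passes to the infimum.\<close>
      have "eventually P (Inf C) \<longleftrightarrow> (\<exists>b\<in>C. eventually P b)" for P
        using chain by (intro eventually_Inf_base False) fastforce
      then have "Inf C \<noteq> bot"
        using CA unfolding trivial_limit_def by auto
      moreover obtain G where "G \<in> C" using False by blast
      then have "Inf C \<le> G" "G \<le> F"
        using CA by (auto intro: Inf_lower)
      then have "Inf C \<le> F" by (rule order_trans)
      ultimately show ?thesis
        by (auto intro: Inf_lower)
    qed
  qed
  then obtain G where G: "G \<noteq> bot" "G \<le> F"
    and max: "\<And>H. H \<noteq> bot \<Longrightarrow> H \<le> F \<Longrightarrow> H \<le> G \<Longrightarrow> H = G" by auto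
  \<comment> \<open>Either cutting \<open>G\<close> down to \<open>A\<close> destroys it, so the
    complement of \<open>A\<close> is in \<open>G\<close>, or the cut is proper and minimality makes
    it equal to \<open>G\<close>.\<close>
  have "eventually (\<lambda>x. x \<in> A) G \<or> eventually (\<lambda>x. x \<notin> A) G" for A
  proof (cases "inf G (principal A) = bot")
    case True
    then show ?thesis
      by (simp add: trivial_limit_def eventually_inf_principal)
  next
    case False
    then have "inf G (principal A) = G"
      using G max by (simp add: le_infI1)
    moreover have "eventually (\<lambda>x. x \<in> A) (inf G (principal A))"
      by (simp add: eventually_inf_principal)
    ultimately show ?thesis by simp
  qed
  with G show ?thesis
    unfolding is_ultrafilter_def by blast
qed

lemma ultrafilter_not_bot: "is_ultrafilter p \<Longrightarrow> p \<noteq> bot"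
  by (simp add: is_ultrafilter_def)

lemma ultrafilter_cases:
  "is_ultrafilter p \<Longrightarrow> eventually P p \<or> eventually (\<lambda>x. \<not> P x) p"
  unfolding is_ultrafilter_def by (drule conjunct2, drule spec[of _ "Collect P"]) simp

lemma ultrafilter_not_eventually:
  assumes "is_ultrafilter p"
  shows "eventually (\<lambda>x. \<not> P x) p \<longleftrightarrow> \<not> eventually P p"
proof
  show "\<not> eventually P p" if "eventually (\<lambda>x. \<not> P x) p"
  proof
    assume "eventually P p"
    with that have "eventually (\<lambda>x. False) p"
      by eventually_elim blast
    then show False
      using ultrafilter_not_bot[OF assms] by (simp add: eventually_False)
  qed
qed (use ultrafilter_cases[OF assms] in blast)

lemma ultrafilter_filtermap:
  "is_ultrafilter p \<Longrightarrow> is_ultrafilter (filtermap f p)"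
  using ultrafilter_cases[of p] by (simp add: is_ultrafilter_def eventually_filtermap filtermap_bot_iff)

lemma ultrafilter_neq_separate:
  assumes "is_ultrafilter p" "is_ultrafilter q" "p \<noteq> q"
  obtains A where "eventually (\<lambda>x. x \<in> A) p" "eventually (\<lambda>x. x \<in> - A) q"
proof -
  obtain P where "eventually P p \<noteq> eventually P q"
    using assms(3) by (auto simp: filter_eq_iff)
  then consider "eventually P p" "\<not> eventually P q" | "\<not> eventually P p" "eventually P q"
    by blast
  then show ?thesis
  proof cases
    case 1
    then show ?thesis
      using that[of "Collect P"] ultrafilter_not_eventually[OF assms(2)] by simp
  next
    case 2
    then show ?thesis
      using that[of "- Collect P"] ultrafilter_not_eventually[OF assms(1)] by simp
  qed
qed

definition ults :: "'a set \<Rightarrow> 'a filter set" where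
  "ults A = {U. is_ultrafilter U \<and> eventually (\<lambda>x. x \<in> A) U}"

lemma ults_Int: "ults (A \<inter> B) = ults A \<inter> ults B"
  by (auto simp: ults_def eventually_conj_iff)

lemma beta_Zn_eq: "beta_Zn = topology_generated_by (range ults)"
  by (simp add: beta_Zn_def ults_def image_def)

lemma topspace_beta: "topspace beta_Zn = {p. is_ultrafilter p}"
  unfolding beta_Zn_eq topology_generated_by_topspace
  by (auto simp: ults_def intro!: exI[of _ UNIV])

lemma openin_beta_ults: "openin beta_Zn (ults A)"
  unfolding beta_Zn_eq by (rule topology_generated_by_Basis) simp

text \<open>The generating sets are closed under intersection by \<open>ults_Int\<close>, so the
  subbase is already a base.\<close>

lemma openin_beta:
  "openin beta_Zn U \<longleftrightarrow> U \<subseteq> {p. is_ultrafilter p} \<and> (\<forall>p\<in>U. \<exists>A. p \<in> ults A \<and> ults A \<subseteq> U)"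
  (is "?l \<longleftrightarrow> ?r")
proof
  assume ?l
  then have "generate_topology_on (range ults) U"
    unfolding beta_Zn_eq by (rule openin_topology_generated_by)
  then have "\<forall>p\<in>U. \<exists>A. p \<in> ults A \<and> ults A \<subseteq> U"
  proof induction
    case Empty
    then show ?case by simp
  next
    case (UN K)
    show ?case
    proof
      fix p assume "p \<in> \<Union>K"
      then obtain k where "k \<in> K" "p \<in> k" by blast
      moreover from this obtain A where "p \<in> ults A" "ults A \<subseteq> k"
        using UN.IH by meson
      ultimately show "\<exists>A. p \<in> ults A \<and> ults A \<subseteq> \<Union>K"
        by blast
    qed
  next
    case (Basis s)
    then show ?case by auto
  next
    case (Int a b)
    show ?case
    proof
      fix p assume "p \<in> a \<inter> b"
      then obtain A B where "p \<in> ults A" "ults A \<subseteq> a" "p \<in> ults B" "ults B \<subseteq> b"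
        using Int.IH by blast
      then show "\<exists>A. p \<in> ults A \<and> ults A \<subseteq> a \<inter> b"
        by (intro exI[of _ "A \<inter> B"]) (auto simp: ults_Int)
    qed
  qed
  with \<open>?l\<close> show ?r
    using openin_subset topspace_beta by blast
next
  assume ?r
  then show ?l
    using openin_beta_ults openin_subopen[of beta_Zn U] by meson
qed

lemma compact_space_beta: "compact_space beta_Zn"
  unfolding compact_space_alt
proof safe
  fix \<U> :: "(int^'n) filter set set"
  assume op: "\<forall>U\<in>\<U>. openin beta_Zn U" and cov: "topspace beta_Zn \<subseteq> \<Union>\<U>"
  \<comment> \<open>The cover is refined to basic sets. An ultrafilter below \<open>?F\<close> would
    contain the complement of every index set in \<open>\<A>\<close> and so escape the cover; hence
    finitely many index sets already cover the lattice, and every ultrafilter contains one of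
    them.\<close>
  define \<A> where "\<A> = {A. \<exists>U\<in>\<U>. ults A \<subseteq> U}"
  let ?F = "INF A\<in>\<A>. principal (- A)"
  have "?F = bot"
  proof (rule ccontr)
    assume "?F \<noteq> bot"
    then obtain p where p: "is_ultrafilter p" "p \<le> ?F"
      using ultrafilter_exists by blast
    then obtain U where U: "U \<in> \<U>" "p \<in> U"
      using cov by (auto simp: topspace_beta)
    then obtain A where "p \<in> ults A" "ults A \<subseteq> U"
      using op by (metis openin_beta)
    with U(1) have "A \<in> \<A>" "p \<in> ults A"
      by (auto simp: \<A>_def)
    then have "p \<le> principal (- A)" "eventually (\<lambda>x. x \<in> A) p"
      using p(2) by (auto simp: ults_def le_INF_iff)
    then show False
      using ultrafilter_not_eventually[OF p(1)] by (auto simp: le_principal)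
  qed
  then obtain \<B> where \<B>: "\<B> \<subseteq> \<A>" "finite \<B>" "(INF A\<in>\<B>. principal (- A)) = bot"
    using INF_filter_not_bot[of \<A> "\<lambda>A. principal (- A)"] by blast
  then have "(\<Inter>A\<in>\<B>. - A) = {}"
    using INF_principal_finite[of \<B> uminus] by (simp add: principal_eq_bot_iff)
  then have covB: "\<Union>\<B> = UNIV" by blast
  obtain g where g: "\<And>A. A \<in> \<B> \<Longrightarrow> g A \<in> \<U> \<and> ults A \<subseteq> g A"
    using bchoice[of \<B> "\<lambda>A U. U \<in> \<U> \<and> ults A \<subseteq> U"] \<B>(1) unfolding \<A>_def by blast
  show "\<exists>\<F>. finite \<F> \<and> \<F> \<subseteq> \<U> \<and> topspace beta_Zn \<subseteq> \<Union>\<F>"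
  proof (intro exI conjI subsetI)
    fix p :: "(int^'n) filter" assume "p \<in> topspace beta_Zn"
    then have p: "is_ultrafilter p" by (simp add: topspace_beta)
    have "\<exists>A\<in>\<B>. eventually (\<lambda>x. x \<in> A) p"
    proof (rule ccontr)
      assume "\<not> ?thesis"
      then have "\<forall>A\<in>\<B>. eventually (\<lambda>x. x \<notin> A) p"
        using ultrafilter_cases[OF p] by blast
      then have "eventually (\<lambda>x. \<forall>A\<in>\<B>. x \<notin> A) p"
        by (rule eventually_ball_finite[OF \<B>(2)])
      then have "\<exists>x. \<forall>A\<in>\<B>. x \<notin> A"
        by (rule eventually_happens'[OF ultrafilter_not_bot[OF p]])
      then show False using covB by blast
    qed
    then obtain A where "A \<in> \<B>" "p \<in> ults A"
      using p by (auto simp: ults_def)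
    then show "p \<in> \<Union>(g ` \<B>)"
      using g by blast
  next
    show "finite (g ` \<B>)" "\<And>U. U \<in> g ` \<B> \<Longrightarrow> U \<in> \<U>"
      using g \<B> by auto
  qed
qed

lemma Hausdorff_space_beta: "Hausdorff_space beta_Zn"
  unfolding Hausdorff_space_def topspace_beta
proof safe
  fix p q :: "(int^'n) filter"
  assume pq: "is_ultrafilter p" "is_ultrafilter q" "p \<noteq> q"
  then obtain A where "eventually (\<lambda>x. x \<in> A) p" "eventually (\<lambda>x. x \<in> - A) q"
    by (rule ultrafilter_neq_separate)
  then have "p \<in> ults A" "q \<in> ults (- A)"
    using pq by (auto simp: ults_def)
  moreover have "disjnt (ults A) (ults (- A))"
    by (auto simp: disjnt_iff ults_def ultrafilter_not_eventually)
  ultimately show "\<exists>U V. openin beta_Zn U \<and> openin beta_Zn V \<and> p \<in> U \<and> q \<in> V \<and> disjnt U V"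
    using openin_beta_ults by blast
qed

text \<open>Being an ultrafilter turns "not eventually inside U" into "eventually outside U".
  Without a limit, such sets U cover X, and a finite subcover would be avoided all at once.\<close>

lemma limitin_ultrafilter_exists:
  assumes "compact_space X" "is_ultrafilter p" and f: "\<And>z. f z \<in> topspace X"
  shows "\<exists>y. limitin X f y p"
proof (rule ccontr)
  assume no: "\<not> ?thesis"
  let ?\<U> = "{U. openin X U \<and> eventually (\<lambda>z. f z \<notin> U) p}"
  have "topspace X \<subseteq> \<Union>?\<U>"
    using no ultrafilter_not_eventually[OF assms(2)] unfolding limitin_def by fastforce
  then obtain \<F> where \<F>: "finite \<F>" "\<F> \<subseteq> ?\<U>" "topspace X \<subseteq> \<Union>\<F>"
    using assms(1)[unfolded compact_space_alt, THEN spec, of ?\<U>] by (auto simp: Collect_mono_iff)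
  then have "eventually (\<lambda>z. \<forall>U\<in>\<F>. f z \<notin> U) p"
    by (auto simp: eventually_ball_finite_distrib)
  then have "\<exists>z. \<forall>U\<in>\<F>. f z \<notin> U"
    by (rule eventually_happens'[OF ultrafilter_not_bot[OF assms(2)]])
  then show False using f \<F>(3) by blast
qed

text \<open>As a function of \<open>p\<close> this is the Stone-Cech extension of \<open>f\<close>;
  its value is arbitrary where no limit exists.\<close>

definition ulim :: "'x topology \<Rightarrow> ('a \<Rightarrow> 'x) \<Rightarrow> 'a filter \<Rightarrow> 'x" where
  "ulim X f p = (SOME y. limitin X f y p)"

lemma limitin_ulim:
  assumes "compact_space X" "is_ultrafilter p" "\<And>z. f z \<in> topspace X"
  shows "limitin X f (ulim X f p) p"
proof -
  have "\<exists>y. limitin X f y p"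
    using assms by (intro limitin_ultrafilter_exists)
  then show ?thesis
    unfolding ulim_def by (rule someI_ex)
qed

lemma ulim_eqI:
  assumes "Hausdorff_space X" "is_ultrafilter p" "limitin X f y p"
  shows "ulim X f p = y"
proof -
  have "\<exists>y. limitin X f y p" using assms(3) ..
  then have "limitin X f (ulim X f p) p"
    unfolding ulim_def by (rule someI_ex)
  then show ?thesis
    using limitin_Hausdorff_unique[OF _ assms(3) ultrafilter_not_bot[OF assms(2)] assms(1)] by blast
qed

lemma continuous_map_ulim:
  fixes f :: "int^'n \<Rightarrow> 'x"
  assumes X: "compact_space X" "Hausdorff_space X" and f: "\<And>z. f z \<in> topspace X"
  shows "continuous_map beta_Zn X (ulim X f)"
  unfolding continuous_map_def
proof (intro conjI allI impI)
  have lim: "limitin X f (ulim X f p) p" if "is_ultrafilter p" for p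
    using X(1) that f by (rule limitin_ulim)
  then show "ulim X f \<in> topspace beta_Zn \<rightarrow> topspace X"
    by (auto simp: topspace_beta dest: limitin_topspace)
  fix U assume U: "openin X U"
  show "openin beta_Zn {p \<in> topspace beta_Zn. ulim X f p \<in> U}"
    unfolding openin_beta
  proof (intro conjI ballI)
    fix p assume "p \<in> {p \<in> topspace beta_Zn. ulim X f p \<in> U}"
    then have p: "is_ultrafilter p" "ulim X f p \<in> U" by (auto simp: topspace_beta)
    \<comment> \<open>Values in an open set have limits only in its closure, so U is first shrunk to
      an open V inside a closed C inside U.\<close>
    have "regular_space X"
      using X compact_Hausdorff_imp_regular_space by blast
    then have nb: "neighbourhood_base_of (closedin X) X"
      by (simp add: neighbourhood_base_of_closedin)
    obtain V C where V: "openin X V" "closedin X C" "ulim X f p \<in> V" "V \<subseteq> C" "C \<subseteq> U"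
      using nb[unfolded neighbourhood_base_of, THEN spec[of _ U], THEN spec[of _ "ulim X f p"]]
        U p(2) by blast
    let ?A = "{z. f z \<in> V}"
    show "\<exists>A. p \<in> ults A \<and> ults A \<subseteq> {p \<in> topspace beta_Zn. ulim X f p \<in> U}"
    proof (intro exI conjI subsetI)
      show "p \<in> ults ?A"
        using lim[OF p(1)] V p(1) by (auto simp: ults_def dest: limitinD)
      fix q assume "q \<in> ults ?A"
      then have q: "is_ultrafilter q" "eventually (\<lambda>z. f z \<in> C) q"
        using V(4) by (auto simp: ults_def elim: eventually_mono)
      then have "ulim X f q \<in> C"
        using limitin_closedin[OF lim V(2)] ultrafilter_not_bot by blast
      then show "q \<in> {p \<in> topspace beta_Zn. ulim X f p \<in> U}"
        using q V(5) by (auto simp: topspace_beta)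
    qed
  qed (auto simp: topspace_beta)
qed

subsection \<open>The semigroup of ultrafilters\<close>

text \<open>The extension of addition to ultrafilters, with \<open>p\<close> as the outer variable:
  on the lattice it is the limit of the shifts of \<open>q\<close> by z as z tends to
  \<open>p\<close>.\<close>

definition conv :: "'a::plus filter \<Rightarrow> 'a filter \<Rightarrow> 'a filter" where
  "conv p q = Abs_filter (\<lambda>P. eventually (\<lambda>z. eventually (\<lambda>w. P (w + z)) q) p)"

lemma eventually_conv:
  "eventually P (conv p q) \<longleftrightarrow> eventually (\<lambda>z. eventually (\<lambda>w. P (w + z)) q) p"
  unfolding conv_def
proof (rule eventually_Abs_filter, rule is_filter.intro)
  show "\<forall>\<^sub>F z in p. \<forall>\<^sub>F w in q. P (w + z) \<and> Q (w + z)"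
    if "\<forall>\<^sub>F z in p. \<forall>\<^sub>F w in q. P (w + z)" "\<forall>\<^sub>F z in p. \<forall>\<^sub>F w in q. Q (w + z)" for P Q
    using that by eventually_elim (rule eventually_conj)
  show "\<forall>\<^sub>F z in p. \<forall>\<^sub>F w in q. Q (w + z)"
    if "\<forall>x. P x \<longrightarrow> Q x" "\<forall>\<^sub>F z in p. \<forall>\<^sub>F w in q. P (w + z)" for P Q
    using that(2) by eventually_elim (use that(1) in \<open>auto elim: eventually_mono\<close>)
qed simp

lemma eventually_shift: "eventually P (shift_beta N p) \<longleftrightarrow> eventually (\<lambda>z. P (z + N)) p"
  by (simp add: shift_beta_def eventually_filtermap)

lemma shift_shift: "shift_beta M (shift_beta N p) = shift_beta (M + N) p"
  by (simp add: filter_eq_iff eventually_shift ac_simps)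

lemma ultrafilter_shift: "is_ultrafilter p \<Longrightarrow> is_ultrafilter (shift_beta N p)"
  unfolding shift_beta_def by (rule ultrafilter_filtermap)

lemma ultrafilter_conv:
  assumes "is_ultrafilter p" "is_ultrafilter q"
  shows "is_ultrafilter (conv p q)"
proof -
  have "\<not> eventually (\<lambda>x. False) (conv p q)"
    unfolding eventually_conv
    using ultrafilter_not_bot[OF assms(1)] ultrafilter_not_bot[OF assms(2)] by simp
  then show ?thesis
    unfolding is_ultrafilter_def trivial_limit_def
    by (simp add: eventually_conv ultrafilter_not_eventually assms)
qed

lemma conv_assoc:
  fixes p q r :: "'a::semigroup_add filter"
  shows "conv (conv p q) r = conv p (conv q r)"
  by (simp add: filter_eq_iff eventually_conv add.assoc)

text \<open>Right multiplication by \<open>q\<close> is thus equivariant and maps invariant sets to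
  invariant sets.\<close>

lemma shift_conv: "shift_beta N (conv p q) = conv (shift_beta N p) q"
  by (simp add: filter_eq_iff eventually_conv eventually_shift add.assoc)

text \<open>The preimage of a basic set is basic: the translates of A by -z that belong to
  \<open>q\<close> are indexed by a set of z determined by A and \<open>q\<close> alone, and
  \<open>conv p q\<close> contains A iff \<open>p\<close> contains that set.\<close>

lemma continuous_map_conv:
  fixes q :: "(int^'n) filter"
  assumes q: "is_ultrafilter q"
  shows "continuous_map beta_Zn beta_Zn (\<lambda>p. conv p q)"
  unfolding continuous_map_def
proof (intro conjI allI impI)
  show "(\<lambda>p. conv p q) \<in> topspace beta_Zn \<rightarrow> topspace beta_Zn"
    using q by (auto simp: topspace_beta ultrafilter_conv)
  fix U :: "(int^'n) filter set" assume U: "openin beta_Zn U"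
  show "openin beta_Zn {p \<in> topspace beta_Zn. conv p q \<in> U}"
    unfolding openin_beta
  proof (intro conjI ballI)
    fix p assume "p \<in> {p \<in> topspace beta_Zn. conv p q \<in> U}"
    then have p: "is_ultrafilter p" "conv p q \<in> U" by (auto simp: topspace_beta)
    then obtain A where A: "conv p q \<in> ults A" "ults A \<subseteq> U"
      using U by (metis openin_beta)
    let ?B = "{z. eventually (\<lambda>w. w + z \<in> A) q}"
    have "r \<in> ults ?B \<longleftrightarrow> is_ultrafilter r \<and> conv r q \<in> ults A" for r
      using q by (auto simp: ults_def eventually_conv intro: ultrafilter_conv)
    then show "\<exists>B. p \<in> ults B \<and> ults B \<subseteq> {p \<in> topspace beta_Zn. conv p q \<in> U}"
      using A p by (intro exI[of _ ?B]) (auto simp: topspace_beta)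
  qed (auto simp: topspace_beta)
qed

lemma limitin_shift_conv:
  fixes p q :: "(int^'n) filter"
  assumes "is_ultrafilter p" "is_ultrafilter q"
  shows "limitin beta_Zn (\<lambda>z. shift_beta z q) (conv p q) p"
  unfolding limitin_def
proof (intro conjI allI impI)
  show "conv p q \<in> topspace beta_Zn"
    using assms by (simp add: topspace_beta ultrafilter_conv)
  fix U assume "openin beta_Zn U \<and> conv p q \<in> U"
  then obtain A where A: "conv p q \<in> ults A" "ults A \<subseteq> U"
    by (metis openin_beta)
  then have "eventually (\<lambda>z. eventually (\<lambda>w. w + z \<in> A) q) p"
    by (simp add: ults_def eventually_conv)
  then show "\<forall>\<^sub>F z in p. shift_beta z q \<in> U"
    by eventually_elim (use A(2) assms(2) in \<open>auto simp: ults_def eventually_shift ultrafilter_shift\<close>)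
qed

text \<open>The Ellis-Numakura argument. In a minimal closed subsemigroup T, the set T u is again a
  closed subsemigroup, so T u = T and some p in T solves p u = u. These solutions form a closed
  subsemigroup, hence all of T, and u is one of them.\<close>

lemma idempotent_exists:
  fixes S :: "(int^'n) filter set"
  assumes S: "closedin beta_Zn S" "S \<noteq> {}" "\<And>p q. p \<in> S \<Longrightarrow> q \<in> S \<Longrightarrow> conv p q \<in> S"
  shows "\<exists>u\<in>S. conv u u = u"
proof -
  define \<A> where "\<A> = {T. T \<subseteq> S \<and> T \<noteq> {} \<and> closedin beta_Zn T \<and> (\<forall>p\<in>T. \<forall>q\<in>T. conv p q \<in> T)}"
  have "\<exists>m\<in>\<A>. \<forall>a\<in>\<A>. a \<subseteq> m \<longrightarrow> a = m"
  proof (rule predicate_Zorn)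
    show "partial_order_on \<A> (relation_of (\<lambda>x y. y \<subseteq> x) \<A>)"
      by (rule partial_order_on_relation_ofI) auto
    fix C assume C: "C \<in> Chains (relation_of (\<lambda>x y. y \<subseteq> x) \<A>)"
    then have CA: "C \<subseteq> \<A>" and chain: "\<And>G H. G \<in> C \<Longrightarrow> H \<in> C \<Longrightarrow> G \<subseteq> H \<or> H \<subseteq> G"
      by (auto simp: Chains_def relation_of_def)
    show "\<exists>u\<in>\<A>. \<forall>a\<in>C. u \<subseteq> a"
    proof (cases "C = {}")
      case True
      with S show ?thesis by (auto simp: \<A>_def)
    next
      case False
      \<comment> \<open>A finite part of a chain has a least member, which gives the finite
        intersection property; compactness then keeps the intersection of the chain
        nonempty.\<close>
      have fin: "\<exists>T\<in>C. T \<subseteq> \<Inter>\<F>" if "finite \<F>" "\<F> \<subseteq> C" for \<F>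
        using that
      proof induction
        case empty
        then show ?case using False by auto
      next
        case (insert x F)
        then obtain T where "T \<in> C" "T \<subseteq> \<Inter>F" "x \<in> C" by auto
        with chain[of T x] show ?case by auto
      qed
      have "\<Inter>C \<noteq> {}"
      proof (rule compact_space_fip[THEN iffD1, OF compact_space_beta, rule_format])
        show "(\<forall>T\<in>C. closedin beta_Zn T) \<and> (\<forall>\<F>. finite \<F> \<and> \<F> \<subseteq> C \<longrightarrow> \<Inter>\<F> \<noteq> {})"
        proof (intro conjI ballI allI impI)
          fix \<F> assume "finite \<F> \<and> \<F> \<subseteq> C"
          then obtain T where "T \<in> C" "T \<subseteq> \<Inter>\<F>" using fin by blast
          moreover from \<open>T \<in> C\<close> have "T \<noteq> {}" using CA by (auto simp: \<A>_def)
          ultimately show "\<Inter>\<F> \<noteq> {}" by blast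
        qed (use CA in \<open>auto simp: \<A>_def\<close>)
      qed
      moreover have "closedin beta_Zn (\<Inter>C)"
        using CA False by (intro closedin_Inter) (auto simp: \<A>_def)
      moreover have "\<Inter>C \<subseteq> S"
        using CA False unfolding \<A>_def by blast
      moreover have "conv p q \<in> \<Inter>C" if "p \<in> \<Inter>C" "q \<in> \<Inter>C" for p q
        using that CA by (auto simp: \<A>_def)
      ultimately have "\<Inter>C \<in> \<A>" by (simp add: \<A>_def)
      then show ?thesis by blast
    qed
  qed
  then obtain T where T: "T \<subseteq> S" "T \<noteq> {}" "closedin beta_Zn T" "\<And>p q. p \<in> T \<Longrightarrow> q \<in> T \<Longrightarrow> conv p q \<in> T"
    and min: "\<And>H. H \<in> \<A> \<Longrightarrow> H \<subseteq> T \<Longrightarrow> H = T" by (auto simp: \<A>_def)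
  have ult: "is_ultrafilter p" if "p \<in> T" for p
    using closedin_subset[OF T(3)] that by (auto simp: topspace_beta)
  obtain u where u: "u \<in> T" using T(2) by blast
  let ?Tu = "(\<lambda>p. conv p u) ` T"
  have "?Tu = T"
  proof (rule min)
    have "compactin beta_Zn T"
      using T(3) compact_space_beta by (rule closedin_compact_space[rotated])
    then have "closedin beta_Zn ?Tu"
      using image_compactin[OF _ continuous_map_conv[OF ult[OF u]]] Hausdorff_space_beta
        compactin_imp_closedin by blast
    moreover have "conv (conv p u) (conv q u) \<in> ?Tu" if "p \<in> T" "q \<in> T" for p q
      using that T(4) u by (intro image_eqI[where x = "conv (conv p u) q"]) (auto simp: conv_assoc)
    moreover have "?Tu \<subseteq> S"
      using T(1,4) u by blast
    ultimately show "?Tu \<in> \<A>"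
      using T(2) by (auto simp: \<A>_def)
  qed (use T(4) u in auto)
  let ?V = "{p \<in> T. conv p u = u}"
  have "?V = T"
  proof (rule min)
    have "?V = T \<inter> {p \<in> topspace beta_Zn. conv p u \<in> {u}}"
      using ult by (auto simp: topspace_beta)
    moreover have "closedin beta_Zn {u}"
      using closedin_t1_singleton[OF Hausdorff_imp_t1_space[OF Hausdorff_space_beta]] ult[OF u]
      by (simp add: topspace_beta)
    then have "closedin beta_Zn {p \<in> topspace beta_Zn. conv p u \<in> {u}}"
      by (rule closedin_continuous_map_preimage[OF continuous_map_conv[OF ult[OF u]]])
    ultimately have "closedin beta_Zn ?V"
      using T(3) by (simp only: closedin_Int)
    moreover have "u \<in> ?Tu"
      using \<open>?Tu = T\<close> u by simp
    then have "?V \<noteq> {}" by auto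
    ultimately show "?V \<in> \<A>"
      using T by (auto simp: \<A>_def conv_assoc)
  qed auto
  then show ?thesis
    using u T(1) by blast
qed

subsection \<open>Minimal invariant sets\<close>

locale minimal_set =
  fixes M :: "(int^'n) filter set"
  assumes minimal: "minimal_invariant_subset M"
begin

lemma closed: "closedin beta_Zn M" and nonempty: "M \<noteq> {}"
  and shift_mem: "p \<in> M \<Longrightarrow> shift_beta N p \<in> M"
  using minimal unfolding minimal_invariant_subset_def invariant_closed_def by blast+

lemma ultrafilter: "p \<in> M \<Longrightarrow> is_ultrafilter p"
  using closedin_subset[OF closed] by (auto simp: topspace_beta)

lemma minimalD:
  assumes "N \<subseteq> M" "N \<noteq> {}" "closedin beta_Zn N" "\<And>k p. p \<in> N \<Longrightarrow> shift_beta k p \<in> N"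
  shows "N = M"
  using minimal assms unfolding minimal_invariant_subset_def invariant_closed_def
  by (simp add: image_subset_iff)

text \<open>M is a left ideal: the product is a limit of shifts of \<open>q\<close>, which stay in
  the closed set M. In particular M is a semigroup.\<close>

lemma conv_mem:
  assumes "is_ultrafilter p" "q \<in> M"
  shows "conv p q \<in> M"
proof (rule limitin_closedin)
  show "limitin beta_Zn (\<lambda>z. shift_beta z q) (conv p q) p"
    using assms ultrafilter by (intro limitin_shift_conv)
qed (use closed assms ultrafilter_not_bot in \<open>auto simp: shift_mem\<close>)

text \<open>For an idempotent u, M u is closed and shift-invariant, hence all of M. Every p is then
  some q u, and p u = q u u = q u = p.\<close>

lemma right_identity_exists: "\<exists>u\<in>M. \<forall>p\<in>M. conv p u = p"
proof -
  obtain u where u: "u \<in> M" "conv u u = u"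
    using idempotent_exists[OF closed nonempty] conv_mem ultrafilter by blast
  let ?N = "(\<lambda>p. conv p u) ` M"
  have "?N = M"
  proof (rule minimalD)
    have "compactin beta_Zn M"
      using closed compact_space_beta by (rule closedin_compact_space[rotated])
    then show "closedin beta_Zn ?N"
      using image_compactin[OF _ continuous_map_conv[OF ultrafilter[OF u(1)]]] Hausdorff_space_beta
        compactin_imp_closedin by blast
  qed (use nonempty conv_mem u ultrafilter in \<open>auto simp: shift_conv shift_mem\<close>)
  have "conv p u = p" if "p \<in> M" for p
  proof -
    obtain q where "p = conv q u" using \<open>?N = M\<close> \<open>p \<in> M\<close> by blast
    then show ?thesis by (simp add: conv_assoc u(2))
  qed
  with u(1) show ?thesis by blast
qed

end

subsection \<open>Quotient topologies\<close>

text \<open>The quotient topology carried by the values of \<open>f\<close> in place of equivalence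
  classes, which leaves the type of the points free.\<close>

definition image_topology :: "'a topology \<Rightarrow> ('a \<Rightarrow> 'b) \<Rightarrow> 'b topology" where
  "image_topology X f = topology (\<lambda>U. U \<subseteq> f ` topspace X \<and> openin X {x \<in> topspace X. f x \<in> U})"

lemma openin_image_topology:
  "openin (image_topology X f) U \<longleftrightarrow> U \<subseteq> f ` topspace X \<and> openin X {x \<in> topspace X. f x \<in> U}"
proof -
  let ?L = "\<lambda>U. U \<subseteq> f ` topspace X \<and> openin X {x \<in> topspace X. f x \<in> U}"
  have "istopology ?L"
    unfolding istopology_def
  proof (intro conjI allI impI)
    fix S T assume "?L S" "?L T"
    moreover have "{x \<in> topspace X. f x \<in> S \<inter> T} = {x \<in> topspace X. f x \<in> S} \<inter> {x \<in> topspace X. f x \<in> T}"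
      by auto
    ultimately show "S \<inter> T \<subseteq> f ` topspace X" "openin X {x \<in> topspace X. f x \<in> S \<inter> T}"
      by (auto simp only: openin_Int)
  next
    fix \<K> assume K: "\<forall>K\<in>\<K>. ?L K"
    then show "\<Union>\<K> \<subseteq> f ` topspace X" by blast
    have "{x \<in> topspace X. f x \<in> \<Union>\<K>} = (\<Union>K\<in>\<K>. {x \<in> topspace X. f x \<in> K})"
      by auto
    with K show "openin X {x \<in> topspace X. f x \<in> \<Union>\<K>}"
      by (auto simp only:)
  qed
  then show ?thesis
    by (simp add: image_topology_def topology_inverse')
qed

lemma topspace_image_topology [simp]: "topspace (image_topology X f) = f ` topspace X"
proof
  have "{x \<in> topspace X. f x \<in> f ` topspace X} = topspace X" by auto
  then have "openin (image_topology X f) (f ` topspace X)"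
    by (simp add: openin_image_topology)
  then show "f ` topspace X \<subseteq> topspace (image_topology X f)"
    by (rule openin_subset)
qed (use openin_image_topology[of X f "topspace (image_topology X f)"] in simp)

lemma quotient_map_image_topology: "quotient_map X (image_topology X f) f"
  by (simp add: quotient_map_def openin_image_topology)

lemma quotient_topology_eq_image_topology:
  assumes "equiv (topspace X) R"
  shows "quotient_topology X R = image_topology X (\<lambda>x. R `` {x})"
proof -
  have quo: "topspace X // R = (\<lambda>x. R `` {x}) ` topspace X"
    by (auto simp: quotient_def)
  \<comment> \<open>The union of a set of classes is its preimage under the class map.\<close>
  have Un: "\<Union>U = {x \<in> topspace X. R `` {x} \<in> U}" if "U \<subseteq> topspace X // R" for U
  proof (intro equalityI subsetI)
    fix x assume "x \<in> \<Union>U"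
    then obtain C where C: "C \<in> U" "x \<in> C" by blast
    then have "C \<in> topspace X // R" using that by blast
    then obtain y where y: "C = R `` {y}" "(y, x) \<in> R"
      using C(2) by (auto elim!: quotientE)
    then have "C = R `` {x}" "x \<in> topspace X"
      using assms equiv_class_eq[OF assms y(2)] by (auto simp: equiv_def)
    with C(1) show "x \<in> {x \<in> topspace X. R `` {x} \<in> U}" by simp
  qed (use assms in \<open>auto intro: equiv_class_self\<close>)
  show ?thesis
    unfolding quotient_topology_def image_topology_def quo[symmetric]
    by (rule arg_cong[where f = topology], rule ext) (metis Un)
qed

lemma homeomorphic_space_quotient_maps:
  assumes f: "quotient_map P X f" and g: "quotient_map P Y g"
    and eq: "\<And>x y. x \<in> topspace P \<Longrightarrow> y \<in> topspace P \<Longrightarrow> f x = f y \<longleftrightarrow> g x = g y"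
  shows "X homeomorphic_space Y"
proof -
  obtain h where h: "continuous_map X Y h" "\<And>x. x \<in> topspace P \<Longrightarrow> h (f x) = g x"
    using quotient_map_lift_exists[OF f quotient_imp_continuous_map[OF g]] eq by metis
  obtain k where k: "continuous_map Y X k" "\<And>x. x \<in> topspace P \<Longrightarrow> k (g x) = f x"
    using quotient_map_lift_exists[OF g quotient_imp_continuous_map[OF f]] eq by metis
  have "homeomorphic_maps X Y h k"
    unfolding homeomorphic_maps_def
    using h k by (auto simp flip: quotient_imp_surjective_map[OF f] quotient_imp_surjective_map[OF g])
  then show ?thesis
    unfolding homeomorphic_space_def by blast
qed

subsection \<open>The integer lattice\<close>

definition rvec :: "int^'n \<Rightarrow> real^'n" where
  "rvec z = (\<chi> j. of_int (z $ j))"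

lemma rvec_nth [simp]: "rvec z $ j = of_int (z $ j)"
  by (simp add: rvec_def)

lemma rvec_0 [simp]: "rvec 0 = 0"
  by (simp add: vec_eq_iff)

lemma rvec_add: "rvec (y + z) = rvec y + rvec z"
  by (simp add: vec_eq_iff)

lemma rvec_diff: "rvec (y - z) = rvec y - rvec z"
  by (simp add: vec_eq_iff)

lemma rvec_eq_iff [simp]: "rvec y = rvec z \<longleftrightarrow> y = z"
  by (simp add: vec_eq_iff)

lemma cube_translate_exists: "\<exists>k. x - rvec k \<in> cube"
proof (intro exI)
  have "0 \<le> x $ j - of_int \<lfloor>x $ j\<rfloor> \<and> x $ j - of_int \<lfloor>x $ j\<rfloor> \<le> 1" for j
    by linarith
  then show "x - rvec (\<chi> j. \<lfloor>x $ j\<rfloor>) \<in> cube"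
    by (simp add: cube_def)
qed

lemma compact_cube: "compact (cube :: (real^'n) set)"
proof -
  have "cube = cbox (0 :: real^'n) 1"
    by (auto simp: cube_def mem_box_cart)
  then show ?thesis
    by (metis compact_cbox)
qed

text \<open>Serves to separate points of the suspension: if x - y is close enough to a lattice
  vector, it equals that vector. Coordinatewise, the bound is 1 at an integer and the distance to
  the nearest integer elsewhere.\<close>

lemma lattice_isolated:
  fixes x :: "real^'n"
  obtains d where "d > 0" "\<And>k. norm (x - rvec k) < d \<Longrightarrow> x = rvec k"
proof -
  have "\<exists>d>0. \<forall>m::int. \<bar>r - of_int m\<bar> < d \<longrightarrow> r = of_int m" for r :: real
  proof (cases "r \<in> \<int>")
    case True
    then show ?thesis by (intro exI[of _ 1]) (auto elim!: Ints_cases)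
  next
    case False
    then have "0 < frac r" "frac r < 1" by (simp_all add: frac_lt_1)
    moreover have False if "\<bar>r - of_int m\<bar> < min (frac r) (1 - frac r)" for m :: int
    proof -
      have "m > \<lfloor>r\<rfloor>" "m < \<lfloor>r\<rfloor> + 1" using that unfolding frac_def by linarith+
      then show False by simp
    qed
    ultimately show ?thesis by (intro exI[of _ "min (frac r) (1 - frac r)"]) auto
  qed
  then obtain d where d: "\<And>r::real. d r > 0" "\<And>r m::int. \<bar>r - of_int m\<bar> < d r \<Longrightarrow> r = of_int m"
    by metis
  show ?thesis
  proof
    show "Min (range (\<lambda>j. d (x $ j))) > 0"
      using d(1) by simp
    fix k :: "int^'n" assume less: "norm (x - rvec k) < Min (range (\<lambda>j. d (x $ j)))"
    have "x $ j = of_int (k $ j)" for j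
    proof (rule d(2))
      have "\<bar>(x - rvec k) $ j\<bar> \<le> norm (x - rvec k)"
        by (rule component_le_norm_cart)
      also have "\<dots> < d (x $ j)"
        using less by simp
      finally show "\<bar>x $ j - of_int (k $ j)\<bar> < d (x $ j)" by simp
    qed
    then show "x = rvec k" by (simp add: vec_eq_iff)
  qed
qed

subsection \<open>The suspension of a minimal set\<close>

text \<open>The class of \<open>(p, x)\<close> is encoded by the sets of the ultrafilter \<open>p + x\<close> on the discrete
  space \<open>\<real>\<^sup>n\<close>; in this form it has the type over which universality is tested.\<close>
definition translate :: "(int^'n) filter \<times> (real^'n) \<Rightarrow> (real^'n) set set" where
  "translate = (\<lambda>(p, x). {S. eventually (\<lambda>z. rvec z + x \<in> S) p})"

lemma translate_shift: "translate (shift_beta k p, x) = translate (p, x + rvec k)"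
  by (simp add: translate_def eventually_shift rvec_add ac_simps)

lemma translate_eq_iff:
  assumes "is_ultrafilter p" "is_ultrafilter q"
  shows "translate (p, x) = translate (q, y) \<longleftrightarrow> (\<exists>k. q = shift_beta k p \<and> x = y + rvec k)"
proof
  assume "\<exists>k. q = shift_beta k p \<and> x = y + rvec k"
  then show "translate (p, x) = translate (q, y)"
    by (auto simp: translate_shift)
next
  assume eq: "translate (p, x) = translate (q, y)"
  have ev: "eventually (\<lambda>z. rvec z + x \<in> S) p \<longleftrightarrow> eventually (\<lambda>z. rvec z + y \<in> S) q" for S
    using eq by (auto simp: translate_def set_eq_iff)
  \<comment> \<open>The coset of the lattice through \<open>x\<close> is the first test set: it
    belongs to both ultrafilters, so it meets the coset through \<open>y\<close>, and
    \<open>x - y\<close> is integral.\<close>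
  have "eventually (\<lambda>z. rvec z + y \<in> range (\<lambda>z. rvec z + x)) q"
    unfolding ev[symmetric] by simp
  then obtain w z where "rvec w + y = rvec z + x"
    using eventually_happens'[OF ultrafilter_not_bot[OF assms(2)]] by fastforce
  then have x: "x = y + rvec (w - z)"
    by (simp add: rvec_diff algebra_simps)
  \<comment> \<open>The second test set is the copy of \<open>P\<close> in the coset through
    \<open>y\<close>; read from \<open>x\<close>, it appears shifted by
    \<open>w - z\<close>.\<close>
  have "eventually P (shift_beta (w - z) p) = eventually P q" for P
  proof -
    have "rvec v + y \<in> {rvec u + y |u. P u} \<longleftrightarrow> P v" for v
      by auto
    moreover have "rvec v + x \<in> {rvec u + y |u. P u} \<longleftrightarrow> P (v + (w - z))" for v
    proof -
      have "rvec v + x = rvec (v + (w - z)) + y"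
        by (simp add: x rvec_add)
      then show ?thesis by auto
    qed
    ultimately show ?thesis
      using ev[of "{rvec u + y |u. P u}"] by (simp only: eventually_shift)
  qed
  with x show "\<exists>k. q = shift_beta k p \<and> x = y + rvec k"
    by (metis filter_eq_iff)
qed

text \<open>Push-forward of an ultrafilter under y |-> y + g, written for ultrafilters given as sets
  of sets.\<close>

definition translate_act :: "real^'n \<Rightarrow> (real^'n) set set \<Rightarrow> (real^'n) set set" where
  "translate_act g s = {S. (\<lambda>y. y + g) -` S \<in> s}"

lemma translate_act_translate: "translate_act g (translate (p, x)) = translate (p, x + g)"
  by (simp add: translate_act_def translate_def add.assoc)

lemma continuous_map_shift:
  fixes k :: "int^'n"
  shows "continuous_map beta_Zn beta_Zn (shift_beta k)"
  unfolding continuous_map_def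
proof (intro conjI allI impI)
  show "shift_beta k \<in> topspace beta_Zn \<rightarrow> topspace beta_Zn"
    by (auto simp: topspace_beta ultrafilter_shift)
  fix U :: "(int^'n) filter set" assume U: "openin beta_Zn U"
  show "openin beta_Zn {p \<in> topspace beta_Zn. shift_beta k p \<in> U}"
    unfolding openin_beta
  proof (intro conjI ballI)
    fix p assume "p \<in> {p \<in> topspace beta_Zn. shift_beta k p \<in> U}"
    then have p: "is_ultrafilter p" "shift_beta k p \<in> U" by (auto simp: topspace_beta)
    then obtain A where A: "shift_beta k p \<in> ults A" "ults A \<subseteq> U"
      using U by (metis openin_beta)
    have "r \<in> ults {z. z + k \<in> A} \<longleftrightarrow> is_ultrafilter r \<and> shift_beta k r \<in> ults A" for r
      by (auto simp: ults_def eventually_shift intro: ultrafilter_shift)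
    then show "\<exists>B. p \<in> ults B \<and> ults B \<subseteq> {p \<in> topspace beta_Zn. shift_beta k p \<in> U}"
      using A p by (intro exI[of _ "{z. z + k \<in> A}"]) (auto simp: topspace_beta)
  qed (auto simp: topspace_beta)
qed

context minimal_set
begin

abbreviation MT :: "(int^'n) filter topology" where
  "MT \<equiv> subtopology beta_Zn M"

abbreviation MxR :: "((int^'n) filter \<times> (real^'n)) topology" where
  "MxR \<equiv> prod_topology MT euclidean"

definition susp :: "(real^'n) set set topology" where
  "susp = image_topology MxR translate"

lemma topspace_beta_Int [simp]: "topspace beta_Zn \<inter> M = M"
  using closedin_subset[OF closed] by auto

lemma topspace_susp: "topspace susp = translate ` (M \<times> UNIV)"
  by (simp add: susp_def)

lemma quotient_map_translate: "quotient_map MxR susp translate"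
  unfolding susp_def by (rule quotient_map_image_topology)

lemma open_map_translate: "open_map MxR susp translate"
  unfolding open_map_def
proof (intro allI impI)
  fix U assume U: "openin MxR U"
  then have sub: "U \<subseteq> M \<times> UNIV" using openin_subset by fastforce
  \<comment> \<open>The diagonal lattice action, whose orbits on M x R^n are the fibres of
    \<open>translate\<close>. The saturation of an open set is the union of its preimages under
    these continuous maps, hence open.\<close>
  let ?s = "\<lambda>k w. (shift_beta k (fst w), snd w - rvec k)"
  have cont: "continuous_map MxR MxR (?s k)" for k
  proof (intro continuous_map_pairedI)
    show "continuous_map MxR MT (\<lambda>w. shift_beta k (fst w))"
      unfolding continuous_map_in_subtopology
    proof
      have "continuous_map MxR beta_Zn fst"
        using continuous_map_fst[of MT] continuous_map_into_fulltopology by blast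
      from continuous_map_compose[OF this continuous_map_shift]
      show "continuous_map MxR beta_Zn (\<lambda>w. shift_beta k (fst w))"
        by (simp add: o_def)
    qed (auto simp: shift_mem)
  qed (intro continuous_intros, simp_all)
  have "{w \<in> topspace MxR. translate w \<in> translate ` U} = (\<Union>k. {w \<in> topspace MxR. ?s k w \<in> U})"
  proof (intro equalityI subsetI)
    fix w assume w: "w \<in> {w \<in> topspace MxR. translate w \<in> translate ` U}"
    then obtain u where u: "u \<in> U" "translate w = translate u" by blast
    have "is_ultrafilter (fst w)" "is_ultrafilter (fst u)"
      using w u(1) sub ultrafilter by auto
    then obtain k where "fst u = shift_beta k (fst w)" "snd w = snd u + rvec k"
      using u(2) translate_eq_iff[of "fst w" "fst u" "snd w" "snd u"] by auto
    then have "?s k w = u" by (simp add: prod_eq_iff)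
    with u(1) w show "w \<in> (\<Union>k. {w \<in> topspace MxR. ?s k w \<in> U})" by blast
  next
    fix w assume "w \<in> (\<Union>k. {w \<in> topspace MxR. ?s k w \<in> U})"
    then obtain k where w: "w \<in> topspace MxR" "?s k w \<in> U" by blast
    have "translate (?s k w) = translate w"
      by (simp add: translate_shift)
    with w show "w \<in> {w \<in> topspace MxR. translate w \<in> translate ` U}"
      by (metis (mono_tags, lifting) imageI mem_Collect_eq)
  qed
  moreover have "openin MxR (\<Union>k. {w \<in> topspace MxR. ?s k w \<in> U})"
    using openin_continuous_map_preimage[OF cont U] by blast
  ultimately show "openin susp (translate ` U)"
    using sub unfolding susp_def openin_image_topology by auto
qed

text \<open>Since \<open>translate\<close> is open, it suffices to find neighbourhoods of two lifts
  such that no lattice translate of one meets the other. At most one k can bring the second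
  coordinates together, and for that k the ultrafilters themselves are separated.\<close>

lemma Hausdorff_space_susp: "Hausdorff_space susp"
  unfolding Hausdorff_space_def
proof (intro allI impI)
  fix s t assume "s \<in> topspace susp \<and> t \<in> topspace susp \<and> s \<noteq> t"
  then obtain p x q y where pq: "p \<in> M" "q \<in> M" and st: "s = translate (p, x)" "t = translate (q, y)"
    and ne: "translate (p, x) \<noteq> translate (q, y)"
    unfolding topspace_susp by blast
  obtain d where d: "d > 0" "\<And>k. norm (x - y - rvec k) < d \<Longrightarrow> x - y = rvec k"
    using lattice_isolated[of "x - y"] by blast
  have "\<exists>A B. p \<in> ults A \<and> q \<in> ults B \<and>
    (\<forall>k p'. x - y = rvec k \<longrightarrow> p' \<in> ults A \<longrightarrow> shift_beta k p' \<notin> ults B)"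
  proof (cases "\<exists>k. x - y = rvec k")
    case True
    then obtain k where k: "x - y = rvec k" by blast
    then have "shift_beta k p \<noteq> q"
      using ne pq translate_eq_iff[OF ultrafilter ultrafilter, of p q x y]
      by (auto simp: algebra_simps)
    then obtain A where A: "eventually (\<lambda>z. z \<in> A) (shift_beta k p)" "eventually (\<lambda>z. z \<in> - A) q"
      using ultrafilter_neq_separate[of "shift_beta k p" q] pq ultrafilter ultrafilter_shift by metis
    have "shift_beta l p' \<notin> ults (- A)" if "x - y = rvec l" "p' \<in> ults {z. z + k \<in> A}" for l p'
    proof -
      have "l = k" using k that(1) by simp
      then show ?thesis
        using that(2) by (simp add: ults_def eventually_shift ultrafilter_not_eventually)
    qed
    then show ?thesis
      using A pq ultrafilter
      by (intro exI[of _ "{z. z + k \<in> A}"] exI[of _ "- A"]) (auto simp: ults_def eventually_shift)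
  next
    case False
    then show ?thesis
      using pq ultrafilter by (intro exI[of _ UNIV]) (auto simp: ults_def)
  qed
  then obtain A B where AB: "p \<in> ults A" "q \<in> ults B"
    "\<And>k p'. x - y = rvec k \<Longrightarrow> p' \<in> ults A \<Longrightarrow> shift_beta k p' \<notin> ults B" by blast
  \<comment> \<open>The two radii add up to \<open>d\<close>, so a common class forces
    \<open>x - y\<close> to be exactly the lattice vector involved.\<close>
  let ?U = "(ults A \<inter> M) \<times> ball x (d/2)" and ?V = "(ults B \<inter> M) \<times> ball y (d/2)"
  have op: "openin MxR ?U" "openin MxR ?V"
    using openin_beta_ults by (auto simp: openin_prod_Times_iff openin_subtopology)
  have "disjnt (translate ` ?U) (translate ` ?V)"
    unfolding disjnt_iff
  proof (intro allI notI)
    fix r assume "r \<in> translate ` ?U \<and> r \<in> translate ` ?V"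
    then obtain p' x' q' y' where *: "p' \<in> ults A" "q' \<in> ults B" "p' \<in> M" "q' \<in> M"
      "dist x x' < d/2" "dist y y' < d/2" "translate (p', x') = translate (q', y')"
      by auto
    then obtain k where k: "q' = shift_beta k p'" "x' = y' + rvec k"
      using translate_eq_iff[OF ultrafilter ultrafilter] by blast
    have "norm (x - y - rvec k) = norm ((x - x') - (y - y'))"
      using k(2) by (simp add: algebra_simps)
    also have "\<dots> \<le> dist x x' + dist y y'"
      unfolding dist_norm by (rule norm_triangle_ineq4)
    also have "\<dots> < d" using * by simp
    finally have "x - y = rvec k" by (rule d(2))
    with AB(3) * k show False by blast
  qed
  moreover have "openin susp (translate ` ?U)" "openin susp (translate ` ?V)"
    using open_map_translate op unfolding open_map_def by blast+
  moreover have "s \<in> translate ` ?U" "t \<in> translate ` ?V"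
    unfolding st using AB pq d(1) by auto
  ultimately show "\<exists>U V. openin susp U \<and> openin susp V \<and> s \<in> U \<and> t \<in> V \<and> disjnt U V"
    by blast
qed

lemma translate_cube_exists:
  assumes "p \<in> M"
  shows "\<exists>q\<in>M. \<exists>y\<in>cube. \<exists>k. q = shift_beta k p \<and> x = y + rvec k"
proof -
  obtain k where "x - rvec k \<in> cube" using cube_translate_exists by blast
  then show ?thesis
    using assms shift_mem by (intro bexI[of _ "shift_beta k p"] bexI[of _ "x - rvec k"] exI[of _ k]) auto
qed

lemma compactin_M: "compactin beta_Zn M"
  using closed compact_space_beta by (rule closedin_compact_space[rotated])

lemma compact_space_susp: "compact_space susp"
proof -
  have "compactin MxR (M \<times> cube)"
    using compactin_M by (simp add: compactin_Times compactin_subtopology compact_cube)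
  then have "compactin susp (translate ` (M \<times> cube))"
    by (rule image_compactin) (rule quotient_imp_continuous_map[OF quotient_map_translate])
  moreover have "translate ` (M \<times> cube) = topspace susp"
  proof
    show "topspace susp \<subseteq> translate ` (M \<times> cube)"
    proof
      fix s assume "s \<in> topspace susp"
      then obtain p x where px: "p \<in> M" "s = translate (p, x)" by (auto simp: topspace_susp)
      then obtain q y k where "q \<in> M" "y \<in> cube" "q = shift_beta k p" "x = y + rvec k"
        using translate_cube_exists by blast
      then have "s = translate (q, y)" "(q, y) \<in> M \<times> cube"
        using px(2) by (simp_all add: translate_shift)
      then show "s \<in> translate ` (M \<times> cube)" by blast
    qed
  qed (auto simp: topspace_susp)
  ultimately show ?thesis by (simp add: compact_space_def)
qed

lemma is_flow_susp: "is_flow susp translate_act"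
  unfolding is_flow_def
proof (intro conjI allI ballI)
  \<comment> \<open>Joint continuity descends to the suspension because the product of a quotient
    map with the identity of a locally compact space, here the group, is again a quotient
    map.\<close>
  have quo: "quotient_map (prod_topology (euclidean :: (real^'n) topology) MxR) (prod_topology euclidean susp)
     (\<lambda>(g, w). (g, translate w))"
    by (rule quotient_map_prod_right[OF locally_compact_space_euclidean _ quotient_map_translate]) simp
  have "continuous_map (prod_topology euclidean MxR) MxR (\<lambda>w. (fst (snd w), snd (snd w) + fst w))"
    by (intro continuous_map_pairedI continuous_map_add continuous_map_fst
        continuous_map_compose[OF continuous_map_snd, unfolded o_def] continuous_map_snd)
  from continuous_map_compose[OF this quotient_imp_continuous_map[OF quotient_map_translate]]
  have "continuous_map (prod_topology euclidean MxR) susp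
    ((\<lambda>(g, s). translate_act g s) \<circ> (\<lambda>(g, w). (g, translate w)))"
    by (rule continuous_map_eq) (auto simp: translate_act_translate)
  then show "continuous_map (prod_topology euclidean susp) susp (\<lambda>(g, s). translate_act g s)"
    by (rule continuous_compose_quotient_map[OF quo])
qed (auto simp: compact_space_susp Hausdorff_space_susp topspace_susp translate_act_translate
    ac_simps)

lemma minimal_flow_susp: "minimal_flow susp translate_act"
  unfolding minimal_flow_def
proof (intro conjI ballI is_flow_susp)
  show "topspace susp \<noteq> {}" using nonempty by (simp add: topspace_susp)
  fix s assume "s \<in> topspace susp"
  then obtain p x where px: "p \<in> M" "s = translate (p, x)" by (auto simp: topspace_susp)
  define C where "C = susp closure_of range (\<lambda>g. translate_act g s)"
  have orbit: "translate_act g s = translate (p, x + g)" for g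
    by (simp add: px translate_act_translate)
  have "closedin susp C" unfolding C_def by simp
  have "range (\<lambda>g. translate_act g s) \<subseteq> C"
    unfolding C_def using px(1) by (intro closure_of_subset) (auto simp: orbit topspace_susp)
  \<comment> \<open>Asking for all \<open>g\<close> at once makes N shift-invariant, as a shift of
    \<open>q\<close> only reparametrizes its line of translates. N contains \<open>p\<close> because
    these translates form the orbit of \<open>s\<close>.\<close>
  define N where "N = {q \<in> M. \<forall>g. translate (q, g) \<in> C}"
  have "N = M"
  proof (rule minimalD)
    have "translate (p, g) \<in> C" for g
      using \<open>range _ \<subseteq> C\<close> orbit[of "g - x"] by auto
    then show "N \<noteq> {}" using px(1) by (auto simp: N_def)
    show "shift_beta k q \<in> N" if "q \<in> N" for k q
      using that by (auto simp: N_def translate_shift shift_mem)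
    have "closedin MT {q \<in> topspace MT. translate (q, g) \<in> C}" for g
    proof (rule closedin_continuous_map_preimage[OF _ \<open>closedin susp C\<close>])
      have "continuous_map MT MxR (\<lambda>q. (q, g))"
        by (intro continuous_map_pairedI) simp_all
      from continuous_map_compose[OF this quotient_imp_continuous_map[OF quotient_map_translate]]
      show "continuous_map MT susp (\<lambda>q. translate (q, g))"
        by (simp add: o_def)
    qed
    then have "closedin MT (\<Inter>g. {q \<in> topspace MT. translate (q, g) \<in> C})"
      by blast
    moreover have "(\<Inter>g. {q \<in> topspace MT. translate (q, g) \<in> C}) = N"
      by (auto simp: N_def)
    ultimately show "closedin beta_Zn N"
      using closed by (metis closedin_closed_subtopology)
  qed (auto simp: N_def)
  then have "topspace susp \<subseteq> C"
    by (auto simp: topspace_susp N_def)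
  then show "susp closure_of range (\<lambda>g. translate_act g s) = topspace susp"
    unfolding C_def by (simp add: closure_of_subset_topspace subset_antisym)
qed

end

subsection \<open>The equivalence relation h\<close>

text \<open>Only the replacement of 1 by 0 can occur on such an A, so a basic identification of h is
  a lattice shift.\<close>

lemma psi_eq: "A \<subseteq> {j. i $ j = 1} \<Longrightarrow> psi A i = i - rvec (indic_vec A)"
  by (auto simp: vec_eq_iff psi_def indic_vec_def)

lemma psi_cube: "i \<in> cube \<Longrightarrow> psi A i \<in> cube"
  by (simp add: cube_def psi_def)

lemma topspace_cube_top [simp]: "topspace cube_top = cube"
  by (simp add: cube_top_def)

context minimal_set
begin

lemma h_rel_eq:
  "h_rel M = {(a, b). a \<in> M \<times> cube \<and> b \<in> M \<times> cube \<and> translate a = translate b}" (is "_ = ?K")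
proof
  have basic: "h_basic M \<subseteq> ?K"
    by (auto simp: h_basic_def shift_mem psi_cube psi_eq translate_shift)
  have tr: "trans ?K" by (auto simp: trans_def)
  have sub: "h_basic M \<union> (h_basic M)\<inverse> \<subseteq> ?K" using basic by auto
  have "(h_basic M \<union> (h_basic M)\<inverse>)\<^sup>+ \<subseteq> ?K"
  proof
    fix e assume "e \<in> (h_basic M \<union> (h_basic M)\<inverse>)\<^sup>+"
    then have "e \<in> ?K\<^sup>+" using sub by (rule trancl_mono)
    then show "e \<in> ?K" by (simp only: trancl_id[OF tr])
  qed
  then show "h_rel M \<subseteq> ?K" by (auto simp: h_rel_def)
next
  show "?K \<subseteq> h_rel M"
  proof clarify
    fix p q i j
    assume *: "p \<in> M" "i \<in> cube" "q \<in> M" "j \<in> cube" "translate (p, i) = translate (q, j)"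
    then obtain k where k: "q = shift_beta k p" "i = j + rvec k"
      using translate_eq_iff[OF ultrafilter ultrafilter] by blast
    have il: "i $ l = j $ l + of_int (k $ l)" "0 \<le> i $ l" "i $ l \<le> 1" "0 \<le> j $ l" "j $ l \<le> 1" for l
      using * by (auto simp: k(2) cube_def)
    have kl: "k $ l \<in> {-1, 0, 1}" for l
    proof -
      have "- 1 \<le> real_of_int (k $ l)" "real_of_int (k $ l) \<le> 1" using il[of l] by linarith+
      then have "- 1 \<le> k $ l" "k $ l \<le> 1" by linarith+
      then show ?thesis by auto
    qed
    \<comment> \<open>The entries of \<open>k\<close> may have mixed signs, so one basic step need
      not suffice. A holds the coordinates with i = 1 and j = 0, B those with i = 0 and j = 1;
      lowering \<open>i\<close> on A and \<open>j\<close> on B leads both points to the same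
      \<open>?c\<close>.\<close>
    define A B where "A = {l. k $ l = 1}" and "B = {l. k $ l = - 1}"
    have A: "A \<subseteq> {l. i $ l = 1}" and B: "B \<subseteq> {l. j $ l = 1}"
      using il by (auto simp: A_def B_def) (smt (verit) of_int_1 of_int_minus)+
    have AB: "indic_vec A = indic_vec B + k"
      using kl by (auto simp: vec_eq_iff indic_vec_def A_def B_def)
    let ?c = "(shift_beta (indic_vec A) p, psi A i)"
    have "((p, i), ?c) \<in> h_basic M"
      using * A by (auto simp: h_basic_def)
    moreover have "?c = (shift_beta (indic_vec B) q, psi B j)"
      unfolding psi_eq[OF A] psi_eq[OF B] by (simp add: k shift_shift AB rvec_add)
    then have "((q, j), ?c) \<in> h_basic M"
      using * B by (auto simp: h_basic_def)
    ultimately have "((p, i), (q, j)) \<in> (h_basic M \<union> (h_basic M)\<inverse>)\<^sup>+"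
      by (meson UnCI converseI r_into_trancl trancl.trancl_into_trancl)
    then show "((p, i), (q, j)) \<in> h_rel M"
      by (simp add: h_rel_def)
  qed
qed

lemma quotient_map_h_rel:
  "quotient_map (prod_topology MT cube_top) (quotient_topology (prod_topology MT cube_top) (h_rel M))
     (\<lambda>a. h_rel M `` {a})"
proof -
  have "equiv (topspace (prod_topology MT cube_top)) (h_rel M)"
    by (auto simp: h_rel_eq equiv_def refl_on_def sym_def trans_def)
  then show ?thesis
    by (simp add: quotient_topology_eq_image_topology quotient_map_image_topology)
qed

lemma h_rel_class_eq_iff:
  assumes "a \<in> M \<times> cube" "b \<in> M \<times> cube"
  shows "h_rel M `` {a} = h_rel M `` {b} \<longleftrightarrow> translate a = translate b"
  using assms by (auto simp: h_rel_eq)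

lemma compact_space_MT_cube: "compact_space (prod_topology MT cube_top)"
  using compactin_M
  by (simp add: compact_space_prod_topology compact_space_subtopology cube_top_def compact_cube)

end

subsection \<open>Universality\<close>

text \<open>The base point \<open>x0\<close> lies over a right identity \<open>u\<close> of \<open>M\<close>: this makes the composite of the
  orbit map \<open>\<Phi>\<close> with \<open>g\<close> the quotient map \<open>translate\<close> itself, so \<open>\<Phi>\<close> identifies no more than \<open>h\<close> does.\<close>
lemma (in minimal_set) homeomorphic_quotient:
  fixes X :: "'x topology" and act :: "real^'n \<Rightarrow> 'x \<Rightarrow> 'x"
  assumes X: "minimal_flow X act" and g: "flow_hom_onto X act susp translate_act g"
  shows "X homeomorphic_space quotient_topology (prod_topology MT cube_top) (h_rel M)"
proof -
  have cX: "compact_space X" and hX: "Hausdorff_space X"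
    and act_mem: "\<And>v x. x \<in> topspace X \<Longrightarrow> act v x \<in> topspace X"
    and act_add: "\<And>v w x. x \<in> topspace X \<Longrightarrow> act (v + w) x = act v (act w x)"
    and act_cont: "continuous_map (prod_topology euclidean X) X (\<lambda>(v, x). act v x)"
    and dense: "\<And>x. x \<in> topspace X \<Longrightarrow> X closure_of (range (\<lambda>v. act v x)) = topspace X"
    using X unfolding minimal_flow_def is_flow_def by blast+
  have g_cont: "continuous_map X susp g" and g_onto: "g ` topspace X = topspace susp"
    and g_act: "\<And>v x. x \<in> topspace X \<Longrightarrow> g (act v x) = translate_act v (g x)"
    using g unfolding flow_hom_onto_def by blast+
  obtain u where u: "u \<in> M" "\<And>p. p \<in> M \<Longrightarrow> conv p u = p"
    using right_identity_exists by blast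
  then have "translate (u, 0) \<in> g ` topspace X"
    by (simp add: g_onto topspace_susp)
  then obtain x0 where x0: "x0 \<in> topspace X" "g x0 = translate (u, 0)" by auto
  \<comment> \<open>Only integer times of the orbit are sampled, so that \<open>E\<close> is defined
    on ultrafilters of the lattice; \<open>\<Phi>\<close> restores the real times through the
    action.\<close>
  define f where "f z = act (rvec z) x0" for z
  define E where "E = ulim X f"
  define \<Phi> where "\<Phi> = (\<lambda>(p, v). act v (E p))"
  have f_mem: "f z \<in> topspace X" for z
    by (simp add: f_def act_mem x0)
  have lim: "limitin X f (E p) p" if "p \<in> M" for p
    unfolding E_def using cX ultrafilter[OF that] f_mem by (rule limitin_ulim)
  have E_mem: "E p \<in> topspace X" if "p \<in> M" for p
    using lim[OF that] by (rule limitin_topspace)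
  have act_cont1: "continuous_map X X (act v)" for v
  proof -
    have "continuous_map X (prod_topology euclidean X) (\<lambda>x. (v, x))"
      by (intro continuous_map_pairedI) simp_all
    from continuous_map_compose[OF this act_cont] show ?thesis by (simp add: o_def)
  qed
  \<comment> \<open>Integer equivariance of \<open>E\<close> is what makes \<open>\<Phi>\<close>
    constant on the fibres of \<open>translate\<close>.\<close>
  have E_shift: "E (shift_beta k p) = act (rvec k) (E p)" if "p \<in> M" for k p
    unfolding E_def
  proof (rule ulim_eqI[OF hX])
    show "is_ultrafilter (shift_beta k p)"
      using that by (intro ultrafilter shift_mem)
    have "limitin X (act (rvec k) \<circ> f) (act (rvec k) (E p)) p"
      using act_cont1 lim[OF that] by (rule continuous_map_limit)
    moreover have "act (rvec k) \<circ> f = (\<lambda>z. f (z + k))"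
      by (auto simp: f_def rvec_add add.commute act_add[symmetric] x0)
    ultimately show "limitin X f (act (rvec k) (ulim X f p)) (shift_beta k p)"
      by (simp add: limitin_def eventually_shift E_def)
  qed
  \<comment> \<open>Both sides are limits along \<open>p\<close> of the function sending z to the
    class of (\<open>shift_beta z u\<close>, 0): the left by continuity of \<open>g\<close>, the
    right because these shifts converge to \<open>conv p u\<close>, which is
    \<open>p\<close>.\<close>
  have gE: "g (E p) = translate (p, 0)" if "p \<in> M" for p
  proof (rule limitin_Hausdorff_unique)
    show "limitin susp (g \<circ> f) (g (E p)) p"
      using g_cont lim[OF that] by (rule continuous_map_limit)
    have "limitin beta_Zn (\<lambda>z. shift_beta z u) p p"
      using limitin_shift_conv[of p u] u that ultrafilter by simp
    then have "limitin MT (\<lambda>z. shift_beta z u) p p"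
      using that u(1) by (simp add: limitin_subtopology shift_mem)
    moreover have "continuous_map MT MxR (\<lambda>q. (q, 0))"
      by (intro continuous_map_pairedI) simp_all
    then have "continuous_map MT susp (translate \<circ> (\<lambda>q. (q, 0)))"
      using quotient_imp_continuous_map[OF quotient_map_translate] by (rule continuous_map_compose)
    ultimately have "limitin susp ((translate \<circ> (\<lambda>q. (q, 0))) \<circ> (\<lambda>z. shift_beta z u))
      ((translate \<circ> (\<lambda>q. (q, 0))) p) p"
      by (rule continuous_map_limit[rotated])
    moreover have "(translate \<circ> (\<lambda>q. (q, 0))) \<circ> (\<lambda>z. shift_beta z u) = g \<circ> f"
      by (auto simp: f_def g_act x0 translate_act_translate translate_shift)
    ultimately show "limitin susp (g \<circ> f) (translate (p, 0)) p" by simp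
  qed (use that ultrafilter ultrafilter_not_bot Hausdorff_space_susp in auto)
  have g\<Phi>: "g (\<Phi> a) = translate a" if "a \<in> M \<times> UNIV" for a
    using that by (auto simp: \<Phi>_def g_act E_mem gE translate_act_translate)
  have \<Phi>_eq: "\<Phi> a = \<Phi> b" if ab: "a \<in> M \<times> UNIV" "b \<in> M \<times> UNIV" "translate a = translate b" for a b
  proof -
    obtain p x q y where [simp]: "a = (p, x)" "b = (q, y)" by fastforce
    obtain k where "q = shift_beta k p" "x = y + rvec k"
      using ab translate_eq_iff[OF ultrafilter ultrafilter, of p q x y] by auto
    then show ?thesis
      using ab(1) by (simp add: \<Phi>_def E_shift act_add E_mem)
  qed
  let ?P = "prod_topology MT (cube_top :: (real^'n) topology)"
  have \<Phi>_cont: "continuous_map ?P X \<Phi>"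
  proof -
    have "continuous_map MT X E"
      unfolding E_def by (rule continuous_map_from_subtopology[OF continuous_map_ulim[OF cX hX f_mem]])
    moreover have "continuous_map cube_top euclidean (\<lambda>x. x)"
      by (simp add: cube_top_def)
    ultimately have "continuous_map ?P (prod_topology euclidean X) (\<lambda>a. (snd a, E (fst a)))"
      by (intro continuous_map_pairedI continuous_map_compose[OF continuous_map_fst, unfolded o_def]
          continuous_map_compose[OF continuous_map_snd, unfolded o_def])
    from continuous_map_compose[OF this act_cont] show ?thesis
      by (simp add: o_def \<Phi>_def case_prod_unfold)
  qed
  have \<Phi>_onto: "\<Phi> ` (M \<times> cube) = topspace X"
  proof
    have "compactin ?P (M \<times> cube)"
      using compact_space_MT_cube by (simp add: compact_space_def)
    then have "closedin X (\<Phi> ` (M \<times> cube))"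
      using image_compactin[OF _ \<Phi>_cont] compactin_imp_closedin[OF hX] by blast
    moreover obtain p where p: "p \<in> M" using nonempty by blast
    \<comment> \<open>The closed image contains a whole orbit, which is dense by minimality; each
      real time is first moved into the cube by a lattice vector.\<close>
    have "range (\<lambda>v. act v (E p)) \<subseteq> \<Phi> ` (M \<times> cube)"
    proof safe
      fix v
      obtain q y k where q: "q \<in> M" "y \<in> cube" "q = shift_beta k p" "v = y + rvec k"
        using translate_cube_exists[OF p] by blast
      have "\<Phi> (p, v) = \<Phi> (q, y)"
        using p q by (intro \<Phi>_eq) (simp_all add: translate_shift shift_mem)
      then show "act v (E p) \<in> \<Phi> ` (M \<times> cube)"
        using q by (auto simp: \<Phi>_def intro!: image_eqI[of _ _ "(q, y)"])
    qed
    ultimately show "topspace X \<subseteq> \<Phi> ` (M \<times> cube)"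
      using dense[OF E_mem[OF p]] closure_of_minimal by metis
  qed (auto simp: \<Phi>_def act_mem E_mem)
  have "quotient_map ?P X \<Phi>"
    by (rule continuous_imp_quotient_map[OF \<Phi>_cont compact_space_MT_cube hX]) (simp add: \<Phi>_onto)
  then show ?thesis
  proof (rule homeomorphic_space_quotient_maps[OF _ quotient_map_h_rel])
    fix a b assume "a \<in> topspace ?P" "b \<in> topspace ?P"
    then have ab: "a \<in> M \<times> cube" "b \<in> M \<times> cube" by auto
    then have MR: "a \<in> M \<times> UNIV" "b \<in> M \<times> UNIV" by auto
    have "\<Phi> a = \<Phi> b \<longleftrightarrow> translate a = translate b"
    proof
      assume "\<Phi> a = \<Phi> b"
      then show "translate a = translate b"
        using g\<Phi>[OF MR(1)] g\<Phi>[OF MR(2)] by simp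
    qed (rule \<Phi>_eq[OF MR])
    then show "\<Phi> a = \<Phi> b \<longleftrightarrow> h_rel M `` {a} = h_rel M `` {b}"
      by (simp only: h_rel_class_eq_iff[OF ab])
  qed
qed

theorem theorem2:
  fixes M :: "(int^'n) filter set"
    and X :: "'x topology" and act :: "real^'n \<Rightarrow> 'x \<Rightarrow> 'x"
  assumes "minimal_invariant_subset M"
    and "universal_minimal_flow X act"
  shows "X homeomorphic_space
           quotient_topology (prod_topology (subtopology beta_Zn M) cube_top) (h_rel M)"
proof -
  interpret minimal_set M by unfold_locales (fact assms(1))
  \<comment> \<open>Universality can be applied to \<open>susp\<close> because its points are
    encoded in the type over which universality is tested.\<close>
  obtain g where "flow_hom_onto X act susp translate_act g"
    using assms(2) minimal_flow_susp unfolding universal_minimal_flow_def by blast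
  then show ?thesis
    using assms(2) homeomorphic_quotient unfolding universal_minimal_flow_def by blast
qed

end
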